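(* Let $T$ be a finite nonempty index set of training observations $(i,s)$, and let $\mathcal{D}^T=\{(\mathbf{x}^{is},d_{is}) \mid (i,s)\in T\}$ be a training set in which each $d_{is}$ is a positive integer and each $\mathbf{x}^{is}$ is a binary vector of explanatory variables as described in the context. For a parameter vector $\Theta\in\mathbb{R}^K$ let $\hat d_{is}=f(\mathbf{x}^{is};\Theta)$ be the forecast of the exponential factorization machine (EFM) model defined in the context, where $K=1+\sum_{i\in A} l_i+\sum_{i\in A} l_i\times f$, and let $$\mathcal{L}^{\mathrm{ES}}(\Theta)=\frac12\sum_{(i,s)\in T}\bigl[f(\mathbf{x}^{is};\Theta)-d_{is}\bigr]^2,\qquad \mathcal{L}^{\mathrm{PES}}(\Theta)=\frac12\sum_{(i,s)\in T}\left[\frac{f(\mathbf{x}^{is};\Theta)-d_{is}}{d_{is}}\right]^2 .$$ Let $\Theta^*_{\mathrm{ES}}\in\mathbb{R}^K$ be a minimizer of $\mathcal{L}^{\mathrm{ES}}$ over $\mathbb{R}^K$ and let $\Theta^*_{\mathrm{PES}}\in\mathbb{R}^K$ be a minimizer of $\mathcal{L}^{\mathrm{PES}}$ over $\mathbb{R}^K$. Put $d_{\max}=\max\{d_{is}\mid (i,s)\in T\}$ and $d_{\min}=\min\{d_{is}\mid (i,s)\in T\}$. Then: (a) $$\mathcal{L}^{\mathrm{ES}}(\Theta^*_{\mathrm{ES}})\le \mathcal{L}^{\mathrm{ES}}(\Theta^*_{\mathrm{PES}})\le \frac{d_{\max}^2}{d_{\min}^2}\,\mathcal{L}^{\mathrm{ES}}(\Theta^*_{\mathrm{ES}}),$$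 (b) $$\mathcal{L}^{\mathrm{PES}}(\Theta^*_{\mathrm{PES}})\le \mathcal{L}^{\mathrm{PES}}(\Theta^*_{\mathrm{ES}})\le \frac{d_{\max}^2}{d_{\min}^2}\,\mathcal{L}^{\mathrm{PES}}(\Theta^*_{\mathrm{PES}}).$$
   Context: Data. $A=\{1,\dots,a\}$ is the index set of categorical attributes, and for $c\in A$, $L^c=\{1,\dots,l_c\}$ is the index set of levels of attribute $c$. $I=\{(c,c')\mid c<c',\ c,c'\in A\}$ is the set of pairwise attribute interactions. An observation is indexed by a pair $(i,s)$ (item $i$ at store $s$). Its explanatory vector $\mathbf{x}^{is}=(x^{is}_{cj})_{c\in A,\,j\in L^c}$ is binary, with $x^{is}_{cj}=1$ if the observation has level $j$ of attribute $c$ and $0$ otherwise; each observation has exactly one level of each attribute. Its response $d_{is}$ (actual sales) is a positive integer. EFM model. Fix a positive integer $f$ (the dimensionality of the factorization; the same letter is used for the model function $f(\cdot;\cdot)$). The parameters are $\Theta=\{\beta_0,\ \beta_{cj},\ \mu_{cj,p}\mid c\in A,\ j\in L^c,\ p\in\{1,\dots,f\}\}$, all real, identified with a vector in $\mathbb{R}^K$, $K=1+\sum_{i\in A}l_i+\sum_{i\in A}l_i\times f$. The forecast is $$\hat d_{is}=f(\mathbf{x}^{is};\Theta)=\exp\Bigl(\beta_0+\sum_{c\in A}\sum_{j\in L^c}\beta_{cj}x^{is}_{cj}+\sum_{(c,c')\in I}\sum_{j\in L^c}\sum_{j'\in L^{c'}}x^{is}_{cj}x^{is}_{c'j'}\sum_{p=1}^{f}\mu_{cj,p}\,\mu_{c'j',p}\Bigr).$$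 $\mathcal{L}^{\mathrm{ES}}$ is called the error squares (ES) loss and $\mathcal{L}^{\mathrm{PES}}$ the percentage error squares (PES) loss; no regularization is included. The minimizers $\Theta^*_{\mathrm{ES}}$ and $\Theta^*_{\mathrm{PES}}$ are taken as given (assumed to exist). *)

theory Defs
  imports "HOL-Analysis.Analysis"
begin

text \<open>
  The data dimensions are passed explicitly: \<open>a\<close> is the number of attributes, \<open>l c\<close> the number
  of levels of attribute \<open>c\<close>, and \<open>f\<close> the dimensionality of the factorization.
\<close>

definition attributes :: "nat \<Rightarrow> nat set"
  where "attributes a = {1..a}"

definition levels :: "(nat \<Rightarrow> nat) \<Rightarrow> nat \<Rightarrow> nat set"
  where "levels l c = {1..l c}"

definition interactions :: "nat \<Rightarrow> (nat \<times> nat) set"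
  where "interactions a = {(c, c'). c \<in> attributes a \<and> c' \<in> attributes a \<and> c < c'}"

definition explanatory_vector ::
  "nat \<Rightarrow> (nat \<Rightarrow> nat) \<Rightarrow> (nat \<Rightarrow> nat \<Rightarrow> real) \<Rightarrow> bool"
  where "explanatory_vector a l x \<longleftrightarrow>
    (\<forall>c\<in>attributes a. (\<forall>j\<in>levels l c. x c j \<in> {0, 1}) \<and> (\<exists>!j. j \<in> levels l c \<and> x c j = 1))"

text \<open>
  A parameter vector is a real vector indexed by the names of the individual parameters.
  \<open>Mu c j p\<close> stands for \<open>\<mu>\<close> with index \<open>cj,p\<close>.  The names in use form a set of \<open>K\<close> elements, and
  \<open>\<real>\<^sup>K\<close> is rendered as the set of functions that are unconstrained on these names and
  \<open>undefined\<close> elsewhere.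
\<close>

datatype efm_coord = Beta0 | Beta nat nat | Mu nat nat nat

definition efm_coords :: "nat \<Rightarrow> (nat \<Rightarrow> nat) \<Rightarrow> nat \<Rightarrow> efm_coord set"
  where "efm_coords a l f =
    {Beta0}
    \<union> {Beta c j | c j. c \<in> attributes a \<and> j \<in> levels l c}
    \<union> {Mu c j p | c j p. c \<in> attributes a \<and> j \<in> levels l c \<and> p \<in> {1..f}}"

definition efm_params :: "nat \<Rightarrow> (nat \<Rightarrow> nat) \<Rightarrow> nat \<Rightarrow> (efm_coord \<Rightarrow> real) set"
  where "efm_params a l f = efm_coords a l f \<rightarrow>\<^sub>E (UNIV :: real set)"

lemma card_efm_coords:
  "card (efm_coords a l f) = 1 + (\<Sum>i\<in>attributes a. l i) + (\<Sum>i\<in>attributes a. l i) * f"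
proof -
  let ?B = "(\<lambda>(c, j). Beta c j) ` (SIGMA c:{1..a}. {1..l c})"
  let ?M = "(\<lambda>(c, j, p). Mu c j p) ` (SIGMA c:{1..a}. {1..l c} \<times> {1..f})"
  have eq: "efm_coords a l f = {Beta0} \<union> (?B \<union> ?M)"
    by (auto simp: efm_coords_def attributes_def levels_def image_iff)
  have cB: "card ?B = (\<Sum>i\<in>{1..a}. l i)"
    by (subst card_image) (auto simp: inj_on_def)
  have cM: "card ?M = (\<Sum>i\<in>{1..a}. l i) * f"
    by (subst card_image) (auto simp: inj_on_def sum_distrib_right card_cartesian_product)
  have "card (?B \<union> ?M) = card ?B + card ?M"
    by (rule card_Un_disjoint) auto
  moreover have "card ({Beta0} \<union> (?B \<union> ?M)) = 1 + card (?B \<union> ?M)"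
    by (subst card_Un_disjoint) auto
  ultimately show ?thesis
    using eq cB cM by (simp add: attributes_def)
qed

definition efm_forecast ::
  "nat \<Rightarrow> (nat \<Rightarrow> nat) \<Rightarrow> nat \<Rightarrow> (nat \<Rightarrow> nat \<Rightarrow> real) \<Rightarrow> (efm_coord \<Rightarrow> real) \<Rightarrow> real"
  where "efm_forecast a l f x \<Theta> =
    exp (\<Theta> Beta0
      + (\<Sum>c\<in>attributes a. \<Sum>j\<in>levels l c. \<Theta> (Beta c j) * x c j)
      + (\<Sum>(c, c')\<in>interactions a. \<Sum>j\<in>levels l c. \<Sum>j'\<in>levels l c'.
           x c j * x c' j' * (\<Sum>p=1..f. \<Theta> (Mu c j p) * \<Theta> (Mu c' j' p))))"

definition loss_ES ::
  "nat \<Rightarrow> (nat \<Rightarrow> nat) \<Rightarrow> nat \<Rightarrow> ('i \<times> 's) set \<Rightarrow> ('i \<times> 's \<Rightarrow> nat \<Rightarrow> nat \<Rightarrow> real) \<Rightarrow>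
   ('i \<times> 's \<Rightarrow> nat) \<Rightarrow> (efm_coord \<Rightarrow> real) \<Rightarrow> real"
  where "loss_ES a l f T x d \<Theta> =
    1 / 2 * (\<Sum>t\<in>T. (efm_forecast a l f (x t) \<Theta> - real (d t))\<^sup>2)"

definition loss_PES ::
  "nat \<Rightarrow> (nat \<Rightarrow> nat) \<Rightarrow> nat \<Rightarrow> ('i \<times> 's) set \<Rightarrow> ('i \<times> 's \<Rightarrow> nat \<Rightarrow> nat \<Rightarrow> real) \<Rightarrow>
   ('i \<times> 's \<Rightarrow> nat) \<Rightarrow> (efm_coord \<Rightarrow> real) \<Rightarrow> real"
  where "loss_PES a l f T x d \<Theta> =
    1 / 2 * (\<Sum>t\<in>T. ((efm_forecast a l f (x t) \<Theta> - real (d t)) / real (d t))\<^sup>2)"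

end

theory Submission
  imports Defs
begin

text \<open>
  The weights satisfy \<open>dmin\<^sup>2 \<le> d\<^sup>2 \<le> dmax\<^sup>2\<close>, so at every parameter vector the ES loss lies between
  \<open>dmin\<^sup>2\<close> and \<open>dmax\<^sup>2\<close> times the PES loss.  A minimizer of one of two losses that are equivalent
  up to constants \<open>m\<close> and \<open>M\<close> minimizes the other up to the factor \<open>M / m\<close>.
\<close>

lemma loss_ES_le_loss_PES:
  assumes "\<And>t. t \<in> T \<Longrightarrow> 0 < d t" and "\<And>t. t \<in> T \<Longrightarrow> real (d t) \<le> M"
  shows "loss_ES a l f T x d \<Theta> \<le> M\<^sup>2 * loss_PES a l f T x d \<Theta>"
proof -
  have "(y - real (d t))\<^sup>2 \<le> M\<^sup>2 * ((y - real (d t)) / real (d t))\<^sup>2" if "t \<in> T" for t y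
  proof -
    \<comment> \<open>The weight \<open>(real (d t))\<^sup>2\<close> turns relative into absolute
      errors. The cancellation needs \<open>d t\<close> nonzero, since division by zero gives 0 in
      HOL.\<close>
    have "(y - real (d t))\<^sup>2 = (real (d t))\<^sup>2 * ((y - real (d t)) / real (d t))\<^sup>2"
      using assms(1)[OF that] by (simp add: power_divide)
    also have "\<dots> \<le> M\<^sup>2 * ((y - real (d t)) / real (d t))\<^sup>2"
      using assms(2)[OF that] by (intro mult_right_mono power_mono) auto
    finally show ?thesis .
  qed
  then show ?thesis
    by (simp add: loss_ES_def loss_PES_def sum_distrib_left sum_mono flip: sum_divide_distrib)
qed

lemma loss_PES_le_loss_ES:
  assumes "0 < m" and "\<And>t. t \<in> T \<Longrightarrow> m \<le> real (d t)"
  shows "m\<^sup>2 * loss_PES a l f T x d \<Theta> \<le> loss_ES a l f T x d \<Theta>"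
proof -
  have "m\<^sup>2 * ((y - real (d t)) / real (d t))\<^sup>2 \<le> (y - real (d t))\<^sup>2" if "t \<in> T" for t y
  proof -
    have "m\<^sup>2 * ((y - real (d t)) / real (d t))\<^sup>2 \<le> (real (d t))\<^sup>2 * ((y - real (d t)) / real (d t))\<^sup>2"
      using assms(1) assms(2)[OF that] by (intro mult_right_mono power_mono) auto
    \<comment> \<open>Here \<open>d t\<close> is nonzero because \<open>0 < m\<close> and
      \<open>m \<le> real (d t)\<close>.\<close>
    also have "\<dots> = (y - real (d t))\<^sup>2"
      using assms(1) assms(2)[OF that] by (simp add: power_divide)
    finally show ?thesis .
  qed
  then show ?thesis
    by (simp add: loss_ES_def loss_PES_def sum_distrib_left sum_mono flip: sum_divide_distrib)
qed

text \<open>For each factor, one passes to the other objective, uses optimality there, and passes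
  back; the two passages cost \<open>M\<close> and \<open>1 / m\<close>.\<close>

lemma arg_min_equivalent_objectives:
  fixes E P :: "'a \<Rightarrow> real"
  assumes "0 < m" and "0 \<le> M"
    and lower: "\<And>z. m * P z \<le> E z" and upper: "\<And>z. E z \<le> M * P z"
    and "is_arg_min E S u" and "is_arg_min P S v"
  shows "E u \<le> E v" "E v \<le> M / m * E u" "P v \<le> P u" "P u \<le> M / m * P v"
proof -
  show Euv: "E u \<le> E v" and Pvu: "P v \<le> P u"
    using assms(5,6) by (auto simp: is_arg_min_linorder)
  have "E v \<le> M * P v"
    by (rule upper)
  \<comment> \<open>Optimality of \<open>v\<close> for \<open>P\<close> enters here:
    \<open>P v \<le> P u \<le> E u / m\<close>.\<close>
  also have "\<dots> \<le> M * (E u / m)"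
    using Pvu lower[of u] \<open>0 < m\<close> \<open>0 \<le> M\<close>
    by (intro mult_left_mono) (auto simp: field_simps intro: order_trans[OF mult_left_mono])
  finally show "E v \<le> M / m * E u"
    by simp
  \<comment> \<open>The dual chain \<open>m * P u \<le> E u \<le> E v \<le> M * P v\<close> uses
    optimality of \<open>u\<close> for \<open>E\<close>.\<close>
  have "m * P u \<le> M * P v"
    using lower[of u] Euv upper[of v] by linarith
  then show "P u \<le> M / m * P v"
    using \<open>0 < m\<close> by (simp add: field_simps)
qed

theorem theorem4p1:
  fixes a f :: nat and l :: "nat \<Rightarrow> nat"
    and T :: "('i \<times> 's) set"
    and x :: "'i \<times> 's \<Rightarrow> nat \<Rightarrow> nat \<Rightarrow> real"
    and d :: "'i \<times> 's \<Rightarrow> nat"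
    and \<Theta>ES \<Theta>PES :: "efm_coord \<Rightarrow> real"
    and dmax dmin :: real
  assumes "f \<ge> 1"
    and "finite T" and "T \<noteq> {}"
    and "\<And>t. t \<in> T \<Longrightarrow> explanatory_vector a l (x t)"
    and "\<And>t. t \<in> T \<Longrightarrow> d t > 0"
    and "is_arg_min (loss_ES a l f T x d) (\<lambda>\<Theta>. \<Theta> \<in> efm_params a l f) \<Theta>ES"
    and "is_arg_min (loss_PES a l f T x d) (\<lambda>\<Theta>. \<Theta> \<in> efm_params a l f) \<Theta>PES"
    and "dmax = real (Max (d ` T))" and "dmin = real (Min (d ` T))"
  shows "(loss_ES a l f T x d \<Theta>ES \<le> loss_ES a l f T x d \<Theta>PES \<and>
          loss_ES a l f T x d \<Theta>PES \<le> dmax\<^sup>2 / dmin\<^sup>2 * loss_ES a l f T x d \<Theta>ES) \<and>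
         (loss_PES a l f T x d \<Theta>PES \<le> loss_PES a l f T x d \<Theta>ES \<and>
          loss_PES a l f T x d \<Theta>ES \<le> dmax\<^sup>2 / dmin\<^sup>2 * loss_PES a l f T x d \<Theta>PES)"
proof -
  have le: "dmin \<le> real (d t)" "real (d t) \<le> dmax" if "t \<in> T" for t
    using that assms(2,8,9) by simp_all
  \<comment> \<open>The minimum is attained at some observation, so it inherits positivity from
    \<open>d\<close>.\<close>
  have "Min (d ` T) \<in> d ` T"
    using assms(2,3) by (intro Min_in) auto
  then have "0 < dmin"
    using assms(5,9) by auto
  then show ?thesis
    using arg_min_equivalent_objectives[OF _ _ _ _ assms(6,7), of "dmin\<^sup>2" "dmax\<^sup>2"]
      loss_ES_le_loss_PES[of T d dmax a l f x] loss_PES_le_loss_ES[of dmin T d a l f x] assms(5) le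
    by simp
qed

end
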